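(* Let $k\geq 1$ be an integer and let $F_k=2^{2^k}+1$. For any positive integer $n$, the only solution in positive integers $(x,y,z)$ of the Diophantine equation $$((F_k-2)n)^{x}+(2^{2^{k-1}+1}n)^{y}=(F_kn)^{z}$$ is $(x,y,z)=(2,2,2)$.
   Context: For an integer $k\geq 1$, $F_k=2^{2^k}+1$ denotes the $k$-th Fermat number. The exponent in $2^{2^{k-1}+1}$ is $2^{k-1}+1$, i.e. $2^{2^{k-1}+1}=2\cdot 2^{2^{k-1}}$. *)

theory Defs
  imports Main
begin

definition fermat_number :: "nat \<Rightarrow> nat" where
  "fermat_number k = 2 ^ (2 ^ k) + 1"

end

theory Submission
  imports Defs "HOL-Number_Theory.Number_Theory" "HOL-Computational_Algebra.Nth_Powers"
begin

text \<open>
  Write \<open>m = 2^(k-1)\<close>, \<open>u = 2^m\<close>, \<open>a = u^2 - 1\<close>, \<open>b = 2 u\<close>, \<open>c = u^2 + 1\<close>, a Pythagorean triple.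
  If \<open>z\<close> is the largest exponent, the solution is forced by size. Otherwise one cancels the smallest
  power of \<open>n\<close> and plays lifting-the-exponent bounds against \<open>max x y > z\<close>.

  The delicate case is \<open>x < z < y\<close>, \<open>n > 1\<close>. There \<open>a = a1 a2\<close> with \<open>a2^x = n^(z-x)\<close>, and
  \<open>a1^x + b^y n^(y-z) = c^z\<close>. Since \<open>a1^x\<close> is \<open>1\<close> modulo \<open>u^2 = a1 a2 + 1\<close>, either \<open>a1 = 1\<close> or
  \<open>u\<close> divides \<open>x\<close>. For a prime \<open>p\<close> dividing \<open>a2\<close>, \<open>2^z\<close> is then a \<open>u\<close>-th power modulo \<open>p\<close>; as the
  order of \<open>2\<close> is a power of \<open>2\<close> and \<open>p \<le> u + 1\<close>, this makes \<open>z\<close> even. Finally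
  \<open>b^y n^(y-z)\<close> is a difference of two odd squares, and \<open>b^y\<close> is too large for that.
\<close>

section \<open>Lifting the exponent, and factors of powers\<close>

lemma cong_sum_powers:
  fixes A B p :: int
  assumes "[A = B] (mod p)"
  shows "[(\<Sum>i<n. B ^ (n - Suc i) * A ^ i) = int n * B ^ (n - 1)] (mod p)"
proof -
  have "[(\<Sum>i<n. B ^ (n - Suc i) * A ^ i) = (\<Sum>i<n. B ^ (n - 1))] (mod p)"
  proof (rule cong_sum)
    fix i assume "i \<in> {..<n}"
    then have "n - 1 = (n - Suc i) + i" by auto
    then have "B ^ (n - 1) = B ^ (n - Suc i) * B ^ i" by (metis power_add)
    then show "[B ^ (n - Suc i) * A ^ i = B ^ (n - 1)] (mod p)"
      by (metis assms cong_mult cong_pow cong_refl)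
  qed
  then show ?thesis by simp
qed

lemma cong_power_first_order:
  fixes B d :: int
  shows "[(B + d) ^ i = B ^ i + int i * B ^ (i - 1) * d] (mod d\<^sup>2)"
proof (induction i)
  case (Suc i)
  have "[(B + d) * (B + d) ^ i = (B + d) * (B ^ i + int i * B ^ (i - 1) * d)] (mod d\<^sup>2)"
    by (rule cong_mult[OF cong_refl Suc])
  also have "(B + d) * (B ^ i + int i * B ^ (i - 1) * d)
      = (B ^ Suc i + int (Suc i) * B ^ (Suc i - 1) * d) + d\<^sup>2 * (int i * B ^ (i - 1))"
    by (cases i) (simp_all add: algebra_simps power2_eq_square)
  also have "[\<dots> = B ^ Suc i + int (Suc i) * B ^ (Suc i - 1) * d] (mod d\<^sup>2)"
    by (simp add: cong_def)
  finally show ?case by simp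
qed simp

text \<open>Source of the single factor \<open>p\<close> gained when an exponent is multiplied by
  \<open>p\<close>. For odd \<open>p\<close> and \<open>A = B + d\<close>, the first-order terms
  modulo \<open>p^2\<close> add up to a multiple of \<open>0 + 1 + ... + (p - 1)\<close>, which
  \<open>p\<close> divides, and \<open>d\<close> supplies a second \<open>p\<close>. For
  \<open>p = 2\<close> the sum is \<open>A + B\<close>, and \<open>4 dvd A - B\<close> leaves it
  exactly one factor 2.\<close>

lemma sum_powers_prime:
  fixes A B :: int and p :: nat
  assumes p: "prime p" and AB: "int p dvd A - B" and B: "\<not> int p dvd B"
    and four: "p = 2 \<Longrightarrow> 4 dvd A - B"
  obtains s where "(\<Sum>i<p. B ^ (p - Suc i) * A ^ i) = int p * s" "\<not> int p dvd s"
proof (cases "p = 2")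
  case True
  with four obtain q where q: "A - B = 4 * q" by auto
  then have A: "A = B + 4 * q" by simp
  have "{..<p} = {0, 1}" using True by auto
  then have "(\<Sum>i<p. B ^ (p - Suc i) * A ^ i) = int p * (B + 2 * q)"
    using True A by (simp add: algebra_simps)
  moreover have "\<not> int p dvd (B + 2 * q)" using B True by simp
  ultimately show ?thesis using that by blast
next
  case False
  define d where "d = A - B"
  then have A: "A = B + d" by simp
  have pd: "int p dvd d" using AB d_def by simp
  have "odd p" using p False by (metis primes_dvd_imp_eq two_is_prime_nat)
  then obtain h where h: "p = 2 * h + 1" using oddE by blast
  have cong: "[x = y] (mod (int p)\<^sup>2)" if "[x = y] (mod d\<^sup>2)" for x y
    using that pd cong_dvd_modulus dvd_power_same by blast
  have "[(\<Sum>i<p. B ^ (p - Suc i) * A ^ i)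
      = (\<Sum>i<p. B ^ (p - 1) + int i * (B ^ (p - 2) * d))] (mod (int p)\<^sup>2)"
  proof (rule cong_sum)
    fix i assume i: "i \<in> {..<p}"
    have "[B ^ (p - Suc i) * A ^ i
        = B ^ (p - Suc i) * (B ^ i + int i * B ^ (i - 1) * d)] (mod (int p)\<^sup>2)"
      unfolding A by (rule cong_mult[OF cong_refl cong[OF cong_power_first_order]])
    also have "B ^ (p - Suc i) * (B ^ i + int i * B ^ (i - 1) * d)
        = B ^ (p - 1) + int i * (B ^ (p - 2) * d)"
    proof (cases i)
      case (Suc j)
      have "p - 1 = (p - Suc i) + i" "p - 2 = (p - Suc i) + j" using i Suc by auto
      then have "B ^ (p - 1) = B ^ (p - Suc i) * B ^ i" "B ^ (p - 2) = B ^ (p - Suc i) * B ^ j"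
        by (metis power_add)+
      then show ?thesis using Suc by (simp add: algebra_simps)
    qed simp
    finally show "[B ^ (p - Suc i) * A ^ i
      = B ^ (p - 1) + int i * (B ^ (p - 2) * d)] (mod (int p)\<^sup>2)" .
  qed
  also have "(\<Sum>i<p. B ^ (p - 1) + int i * (B ^ (p - 2) * d))
      = int p * B ^ (p - 1) + int (\<Sum>i<p. i) * (B ^ (p - 2) * d)"
    by (simp add: sum.distrib sum_distrib_right)
  also have "(\<Sum>i<p. i) = p * h"
    using h by (simp add: lessThan_atLeast0 Sum_Ico_nat)
  also have "[int p * B ^ (p - 1) + int (p * h) * (B ^ (p - 2) * d) = int p * B ^ (p - 1)] (mod (int p)\<^sup>2)"
  proof -
    have "(int p)\<^sup>2 dvd int (p * h) * (B ^ (p - 2) * d)"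
      using pd by (auto simp: power2_eq_square intro!: mult_dvd_mono)
    then show ?thesis by (simp add: cong_iff_dvd_diff)
  qed
  finally obtain q where q: "(\<Sum>i<p. B ^ (p - Suc i) * A ^ i) - int p * B ^ (p - 1) = (int p)\<^sup>2 * q"
    by (auto simp: cong_iff_dvd_diff)
  have "(\<Sum>i<p. B ^ (p - Suc i) * A ^ i) = int p * (B ^ (p - 1) + int p * q)"
    using q by (simp add: algebra_simps power2_eq_square)
  moreover have "\<not> int p dvd B ^ (p - 1) + int p * q"
    using B p by (metis dvd_add_left_iff dvd_triv_left prime_dvd_power prime_int_nat_transfer prime_nat_int_transfer)
  ultimately show ?thesis using that by blast
qed

text \<open>The upper bound of lifting the exponent, in divisibility form. If \<open>p\<close> does
  not divide \<open>j\<close>, the cofactor of \<open>A - B\<close> is prime to \<open>p\<close>; if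
  \<open>j = p * i\<close>, induction applies to the bases \<open>A ^ p\<close> and
  \<open>B ^ p\<close>, whose difference has gained exactly one factor \<open>p\<close>.\<close>

lemma prime_power_dvd_diff_powers:
  fixes A B :: int and p :: nat
  assumes "prime p" "j > 0" "int p dvd A - B" "\<not> int p dvd B" "p = 2 \<Longrightarrow> 4 dvd A - B"
    "int p ^ t dvd A ^ j - B ^ j"
  shows "int p ^ t dvd (A - B) * int j"
  using assms
proof (induction j arbitrary: A B rule: less_induct)
  case (less j)
  let ?Q = "\<lambda>j. \<Sum>i<j. B ^ (j - Suc i) * A ^ i"
  have ip: "prime (int p)" using less.prems(1) by simp
  have ndB: "\<not> int p dvd B ^ i" for i using less.prems(4) ip prime_dvd_power by blast
  show ?case
  proof (cases "p dvd j")
    case False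
    have "[?Q j = int j * B ^ (j - 1)] (mod int p)"
      by (rule cong_sum_powers) (simp add: cong_iff_dvd_diff less.prems(3))
    moreover have "\<not> int p dvd int j * B ^ (j - 1)"
      using False ndB ip by (auto simp: prime_dvd_mult_iff)
    ultimately have "\<not> int p dvd ?Q j" by (simp add: cong_dvd_iff)
    then have "coprime (int p ^ t) (?Q j)"
      using ip by (simp add: prime_imp_coprime coprime_power_left_iff)
    moreover have "int p ^ t dvd (A - B) * ?Q j"
      using less.prems(6) by (simp add: power_diff_sumr2)
    ultimately have "int p ^ t dvd A - B" by (simp add: coprime_dvd_mult_left_iff)
    then show ?thesis by simp
  next
    case True
    then obtain i where i: "j = p * i" by auto
    have i0: "i > 0" "i < j" using i less.prems(2) prime_gt_1_nat[OF less.prems(1)] by auto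
    obtain s where s: "?Q p = int p * s" "\<not> int p dvd s"
      using sum_powers_prime less.prems by metis
    have diff: "A ^ p - B ^ p = (A - B) * (int p * s)" using s by (simp add: power_diff_sumr2)
    have "int p ^ t dvd (A ^ p - B ^ p) * int i"
    proof (rule less.IH[OF i0(2) less.prems(1) i0(1)])
      show "int p dvd A ^ p - B ^ p" by (simp add: diff)
      show "\<not> int p dvd B ^ p" by (rule ndB)
      show "4 dvd A ^ p - B ^ p" if "p = 2" using less.prems(5)[OF that] by (simp add: diff)
      show "int p ^ t dvd (A ^ p) ^ i - (B ^ p) ^ i"
        using less.prems(6) by (simp add: i power_mult)
    qed
    then have "int p ^ t dvd s * ((A - B) * int j)" by (simp add: diff i algebra_simps)
    moreover have "coprime (int p ^ t) s"
      using s ip by (simp add: prime_imp_coprime coprime_power_left_iff)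
    ultimately show ?thesis by (simp add: coprime_dvd_mult_right_iff)
  qed
qed

text \<open>Collects the bound over all primes of \<open>D\<close> by comparing multiplicities. It
  serves as a size tool: for \<open>A \<noteq> B\<close>, a large \<open>D\<close> forces
  \<open>(A - B) * j\<close> to be large.\<close>

lemma dvd_diff_powers:
  fixes A B :: int and D :: nat
  assumes "j > 0" "D > 0" and dvd: "int D dvd A ^ j - B ^ j"
    and p: "\<And>p. prime p \<Longrightarrow> p dvd D \<Longrightarrow>
      int p dvd A - B \<and> \<not> int p dvd B \<and> (p = 2 \<longrightarrow> 4 dvd A - B)"
  shows "int D dvd (A - B) * int j"
proof (cases "A = B")
  case False
  have "D dvd nat \<bar>(A - B) * int j\<bar>"
  proof (rule multiplicity_le_imp_dvd)
    show "D \<noteq> 0" using assms by simp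
    fix q :: nat assume q: "prime q"
    have "q ^ multiplicity q D dvd nat \<bar>(A - B) * int j\<bar>"
    proof (cases "q dvd D")
      case True
      have "int (q ^ multiplicity q D) dvd int D" by (simp only: int_dvd_int_iff multiplicity_dvd)
      then have "int q ^ multiplicity q D dvd A ^ j - B ^ j" using dvd dvd_trans by fastforce
      then have "int q ^ multiplicity q D dvd (A - B) * int j"
        using prime_power_dvd_diff_powers[OF q assms(1)] p[OF q True] by blast
      then show ?thesis by (metis of_nat_power int_dvd_int_iff dvd_abs_iff int_nat_eq abs_ge_zero)
    qed (simp add: not_dvd_imp_multiplicity_0)
    then show "multiplicity q D \<le> multiplicity q (nat \<bar>(A - B) * int j\<bar>)"
      using False assms(1) q by (intro multiplicity_geI) auto
  qed
  then show ?thesis by simp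
qed simp

text \<open>The cofactor of \<open>s - 1\<close> in \<open>s ^ x - 1\<close> is congruent to
  \<open>x\<close> modulo 2, hence odd, so all factors 2 sit in \<open>s - 1\<close>.\<close>

lemma pow_cong_one_odd_exponent:
  fixes s :: int and x t :: nat
  assumes x: "odd x" and s: "[s ^ x = 1] (mod 2 ^ t)" "t > 0"
  shows "[s = 1] (mod 2 ^ t)"
proof -
  let ?Q = "\<Sum>i<x. 1 ^ (x - Suc i) * s ^ i"
  have dvd: "2 ^ t dvd s ^ x - 1" using s(1) by (simp add: cong_iff_dvd_diff)
  then have "2 dvd s ^ x - 1" using s(2) by (meson dvd_power dvd_trans)
  then have "odd s" using odd_pos[OF x] by auto
  then have "[s = 1] (mod 2)" by (simp add: cong_iff_dvd_diff)
  then have "[?Q = int x * 1 ^ (x - 1)] (mod 2)" by (rule cong_sum_powers)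
  then have "odd ?Q" using x by (simp add: cong_dvd_iff)
  then have "coprime (2 ^ t) ?Q" by simp
  moreover have "s ^ x - 1 = (s - 1) * ?Q"
    using power_diff_sumr2[of s x 1] by simp
  ultimately have "2 ^ t dvd s - 1" using dvd by (simp add: coprime_dvd_mult_left_iff)
  then show ?thesis by (simp add: cong_iff_dvd_diff)
qed

text \<open>Multiplicities add, and \<open>P\<close> holds at most \<open>i\<close> factors
  \<open>p\<close>. Used below to distribute powers of 2 between two factors.\<close>

lemma prime_power_add_dvd_mult:
  fixes P Q p :: "'a :: factorial_semiring"
  assumes "prime p" "p ^ (i + j) dvd P * Q" "\<not> p ^ Suc i dvd P" "Q \<noteq> 0"
  shows "p ^ j dvd Q"
proof -
  have P: "P \<noteq> 0" using assms(3) by auto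
  have p: "\<not> is_unit p" using assms(1) not_prime_unit by blast
  have "i + j \<le> multiplicity p (P * Q)"
    using p assms(2,4) P by (intro multiplicity_geI) auto
  also have "\<dots> = multiplicity p P + multiplicity p Q"
    using assms(1,4) P by (intro prime_elem_multiplicity_mult_distrib) auto
  finally have "i + j \<le> multiplicity p P + multiplicity p Q" .
  moreover have "multiplicity p P < Suc i"
    using p assms(3) P by (intro multiplicity_lessI) auto
  ultimately show ?thesis by (intro multiplicity_dvd') auto
qed

lemma coprime_mult_eq_powerE:
  fixes g h c e :: nat
  assumes "g * h = c ^ e" "coprime g h" "e > 0"
  obtains c1 c2 where "g = c1 ^ e" "h = c2 ^ e" "c1 * c2 = c"
proof -
  have "is_nth_power e (g * h)" using assms(1) by simp
  then obtain c1 c2 where c: "g = c1 ^ e" "h = c2 ^ e"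
    using is_nth_power_mult_coprime_natD[OF assms(2)]
    by (metis is_nth_powerE is_nth_power_mult_coprime_nat_iff assms(2) mult_is_0)
  then have "(c1 * c2) ^ e = c ^ e" using assms(1) by (simp add: power_mult_distrib)
  then have "c1 * c2 = c" using assms(3) by (simp add: power_eq_iff_eq_base)
  with c that show ?thesis by blast
qed

text \<open>Lifting with bases \<open>t^2\<close> and \<open>s^2\<close>, whose difference is
  \<open>e^2\<close>, gives \<open>e ^ x dvd e^2 * j\<close>. Since \<open>x \<ge> j + 2\<close>,
  this would force \<open>e ^ j \<le> j\<close>.\<close>

lemma pythagorean_no_power_quotient:
  fixes e s t w x j :: nat
  assumes pyth: "e\<^sup>2 + s\<^sup>2 = t\<^sup>2" and cop: "coprime e s" and e: "e \<ge> 2" and j: "j > 0" "x > 2 * j"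
    and eq: "e ^ x * w + s ^ (2 * j) = t ^ (2 * j)"
  shows False
proof -
  have diff: "(int t)\<^sup>2 - (int s)\<^sup>2 = (int e)\<^sup>2"
    using arg_cong[OF pyth, of int] by simp
  have "int (e ^ x) dvd ((int t)\<^sup>2 - (int s)\<^sup>2) * int j"
  proof (rule dvd_diff_powers)
    show "j > 0" "e ^ x > 0" using j e by simp_all
    have "((int t)\<^sup>2) ^ j - ((int s)\<^sup>2) ^ j = int (e ^ x) * int w"
      using arg_cong[OF eq, of int] by (simp add: power_mult)
    then show "int (e ^ x) dvd ((int t)\<^sup>2) ^ j - ((int s)\<^sup>2) ^ j" by simp
  next
    fix p :: nat assume p: "prime p" "p dvd e ^ x"
    then have pe: "p dvd e" using prime_dvd_power by blast
    then have "\<not> p dvd s" using cop p(1) by (meson coprime_common_divisor not_prime_unit)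
    then have "\<not> int p dvd (int s)\<^sup>2" using p(1) by (metis int_dvd_int_iff of_nat_power prime_dvd_power)
    moreover have "4 dvd (int e)\<^sup>2" if "p = 2"
    proof -
      have "2 dvd int e" using pe that by presburger
      then show ?thesis using dvd_power_same[of 2 "int e" 2] by simp
    qed
    ultimately show "int p dvd (int t)\<^sup>2 - (int s)\<^sup>2 \<and> \<not> int p dvd (int s)\<^sup>2
        \<and> (p = 2 \<longrightarrow> 4 dvd (int t)\<^sup>2 - (int s)\<^sup>2)"
      using pe by (auto simp: diff power2_eq_square[of "int e"])
  qed
  then have "int (e ^ x) dvd int (e\<^sup>2 * j)" by (simp add: diff)
  then have "e ^ x dvd e\<^sup>2 * j" by (simp only: int_dvd_int_iff)
  then have "e ^ x \<le> e\<^sup>2 * j" using e j by (simp add: dvd_imp_le)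
  moreover have "e ^ (2 + j) \<le> e ^ x" using e j by (intro power_increasing) auto
  ultimately have "e\<^sup>2 * e ^ j \<le> e\<^sup>2 * j" by (simp only: power_add)
  then have "e ^ j \<le> j" using e by simp
  moreover have "j < 2 ^ j" by (rule less_exp)
  moreover have "(2::nat) ^ j \<le> e ^ j" using e by (simp add: power_mono)
  ultimately show False by linarith
qed

section \<open>The Pythagorean triple of a Fermat number\<close>

text \<open>\<open>a + 1 = u\<^sup>2\<close> avoids truncated subtraction.
  \<open>2 * m = 2 ^ k\<close> makes \<open>u\<^sup>2\<close> equal to \<open>2 ^ 2 ^ k\<close>, so
  the order of 2 modulo any divisor of \<open>a\<close> is a power of 2.\<close>

locale fermat_triple =
  fixes k m u a b c :: nat
  assumes k: "k \<ge> 1" and m: "2 * m = 2 ^ k" and u: "u = 2 ^ m"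
    and a: "a + 1 = u\<^sup>2" and b: "b = 2 * u" and c: "c = u\<^sup>2 + 1"
begin

lemma m_pos: "m \<ge> 1"
  using m by (cases m) auto

lemma even_u: "even u" and u_ge: "u \<ge> 2"
proof -
  show even: "even u" using u m_pos by simp
  then show "u \<ge> 2" using u by (intro dvd_imp_le) auto
qed

lemma u_sq: "u\<^sup>2 = 2 ^ (2 * m)"
  by (simp add: u power_mult[symmetric] mult.commute)

lemma u_sq_ge: "u\<^sup>2 \<ge> 4"
  using power_mono[OF u_ge, of 2] by simp

lemma c_eq: "c = a + 2" and a_ge: "a \<ge> 3"
  using a c u_sq_ge by auto

lemma int_a: "int a = (int u)\<^sup>2 - 1"
  using arg_cong[OF a, of int] by simp

lemma int_c: "int c = (int u)\<^sup>2 + 1"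
  using c by simp

lemma pyth: "a\<^sup>2 + b\<^sup>2 = c\<^sup>2"
proof -
  have "int (a\<^sup>2 + b\<^sup>2) = int (c\<^sup>2)"
    by (simp add: int_a int_c b) (simp add: algebra_simps power2_eq_square)
  then show ?thesis by (simp only: of_nat_eq_iff)
qed

lemma odd_a: "odd a" and odd_c: "odd c"
proof -
  have "even (u\<^sup>2)" using even_u by simp
  then show "odd a" "odd c" using a c by presburger+
qed

lemma coprime_ac: "coprime a c"
proof -
  have "coprime a 2" using odd_a by simp
  then show ?thesis unfolding c_eq coprime_iff_gcd_eq_1 by (simp only: gcd_add2)
qed

lemma coprime_cu: "coprime c u"
proof -
  have "coprime (Suc (u\<^sup>2)) (u\<^sup>2)" by (rule coprime_Suc_left_nat)
  then show ?thesis by (simp add: c)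
qed

lemma coprime_au: "coprime a u"
proof -
  have "coprime a (u\<^sup>2)" using coprime_Suc_right_nat[of a] by (simp add: a[symmetric])
  then show ?thesis by simp
qed

lemma coprime_ab: "coprime a b" and coprime_bc: "coprime b c"
  using coprime_au coprime_cu odd_a odd_c by (auto simp: b coprime_commute)

lemma b_eq: "b = 2 ^ (m + 1)"
  by (simp add: b u)

lemma b_ge: "b \<ge> 4"
  using b u_ge by simp

lemma three_dvd_a: "3 dvd a"
proof -
  have "[4 ^ m = 1 ^ m] (mod (3::nat))" by (rule cong_pow) (simp add: cong_def)
  then have "[a + 1 = 0 + 1] (mod 3)" unfolding a u_sq power_mult by simp
  then show ?thesis using cong_add_rcancel_nat[of a 1 0 3] by (simp add: cong_0_iff)
qed

lemma four_dvd_b: "4 dvd b"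
  using b even_u by auto

lemma cong_a_4: "[int a = - 1] (mod 4)"
proof -
  have "2 dvd int u" using even_u by simp
  then have "4 dvd (int u)\<^sup>2" using dvd_power_same[of 2 "int u" 2] by simp
  then show ?thesis by (simp add: int_a cong_iff_dvd_diff)
qed

lemma two_u_sq_dvd: "y \<ge> 2 \<Longrightarrow> 2 * u\<^sup>2 dvd b ^ y"
proof -
  assume "y \<ge> 2"
  then have "b\<^sup>2 dvd b ^ y" by (rule le_imp_power_dvd)
  moreover have "b\<^sup>2 = 2 * u\<^sup>2 * 2" by (simp add: b power2_eq_square)
  then have "2 * u\<^sup>2 dvd b\<^sup>2" by simp
  ultimately show ?thesis using dvd_trans by blast
qed

text \<open>The differences are \<open>u^2 * (u^2 - 2)\<close> and \<open>u^2 * (u^2 + 2)\<close>,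
  and \<open>u\<close> is even. The extra factor 2 in the modulus later keeps \<open>u^2\<close>
  from being congruent to 0.\<close>

lemma cong_a_sq: "[int a ^ 2 = 1] (mod 2 * (int u)\<^sup>2)"
  and cong_c_sq: "[int c ^ 2 = 1] (mod 2 * (int u)\<^sup>2)"
proof -
  obtain h where h: "u = 2 * h" using even_u by auto
  have "int a ^ 2 - 1 = 2 * (int u)\<^sup>2 * (2 * (int h)\<^sup>2 - 1)"
    "int c ^ 2 - 1 = 2 * (int u)\<^sup>2 * (2 * (int h)\<^sup>2 + 1)"
    unfolding int_a int_c h by (simp_all add: algebra_simps power2_eq_square)
  then show "[int a ^ 2 = 1] (mod 2 * (int u)\<^sup>2)" "[int c ^ 2 = 1] (mod 2 * (int u)\<^sup>2)"
    by (simp_all add: cong_iff_dvd_diff)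
qed

lemma cong_even_power:
  assumes "[s ^ 2 = 1] (mod (q::int))" "even x"
  shows "[s ^ x = 1] (mod q)"
  using assms by (metis cong_pow evenE power_mult power_one)

lemma cong_c_2: "p dvd a \<Longrightarrow> [c ^ z = 2 ^ z] (mod p)"
  by (intro cong_pow) (simp add: c_eq cong_iff_dvd_diff flip: cong_int_iff)

section \<open>Cases settled by size, small moduli or direct lifting\<close>

text \<open>With \<open>A = a * n\<close> and so on, \<open>A^2 + B^2 = C^2\<close> and
  \<open>A, B < C\<close>, so \<open>A ^ z + B ^ z < C ^ z\<close> for \<open>z > 2\<close>, and
  smaller \<open>x\<close>, \<open>y\<close> only lower the left side. For \<open>z = 1\<close> the
  equation would read \<open>a + b = c\<close>, that is \<open>b = 2\<close>.\<close>

lemma solution_z_max: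
  assumes eq: "(a * n) ^ x + (b * n) ^ y = (c * n) ^ z" and pos: "n > 0" "x > 0" "y > 0"
    and le: "x \<le> z" "y \<le> z"
  shows "x = 2 \<and> y = 2 \<and> z = 2"
proof -
  let ?A = "a * n" and ?B = "b * n" and ?C = "c * n"
  have "a * n \<ge> a * 1" "b * n \<ge> b * 1" "c * n \<ge> c * 1" using pos by (intro mult_le_mono; simp)+
  then have gt: "?A > 1" "?B > 1" "?C > 1" using a_ge b_ge c_eq by linarith+
  have py: "?A\<^sup>2 + ?B\<^sup>2 = ?C\<^sup>2"
    by (simp add: power_mult_distrib pyth[symmetric] distrib_right)
  have "b < c"
  proof (rule power_less_imp_less_base)
    show "b ^ 2 < c ^ 2" unfolding pyth[symmetric] using a_ge by simp
  qed simp
  then have AC: "?A < ?C" "?B < ?C" using c_eq pos by (simp_all only: mult_less_cancel2) auto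
  have "z \<noteq> 1"
  proof
    assume "z = 1"
    then have "x = 1" "y = 1" using le pos by auto
    with eq \<open>z = 1\<close> have "(a + b) * n = c * n" by (simp add: algebra_simps)
    then have "a + b = c" using pos by simp
    then show False using c_eq b_ge by simp
  qed
  then have "2 \<le> z" using le pos by linarith
  then obtain v where v: "z = 2 + v" using le_Suc_ex by blast
  have le1: "?A ^ x \<le> ?A ^ z" "?B ^ y \<le> ?B ^ z" using le gt by (auto intro: power_increasing)
  have "v = 0"
  proof (rule ccontr)
    assume "v \<noteq> 0"
    then have "?A ^ v < ?C ^ v" "?B ^ v < ?C ^ v" using AC by (auto intro: power_strict_mono)
    then have "?A\<^sup>2 * ?A ^ v + ?B\<^sup>2 * ?B ^ v < ?A\<^sup>2 * ?C ^ v + ?B\<^sup>2 * ?C ^ v"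
      using gt by (intro add_strict_mono mult_strict_left_mono zero_less_power) linarith+
    also have "\<dots> = ?C\<^sup>2 * ?C ^ v" using py by (metis distrib_right)
    finally have "?A ^ z + ?B ^ z < ?C ^ z" by (simp only: v power_add)
    then show False using eq le1 by linarith
  qed
  \<comment> \<open>For \<open>z = 2\<close> the two termwise bounds add up to an equality, so each
    is an equality.\<close>
  then have "?A ^ x = ?A ^ 2" "?B ^ y = ?B ^ 2" using eq le1 py v by auto
  then show ?thesis using gt v \<open>v = 0\<close> by (simp add: power_inject_exp)
qed

text \<open>Even \<open>z\<close> falls to the Pythagorean lifting bound. For odd \<open>z\<close>,
  reduce modulo \<open>u + 1\<close>, an odd divisor of \<open>a\<close>: there \<open>c\<close> is
  2 and \<open>b = 2 * u\<close> is \<open>-2\<close>, so \<open>u + 1\<close> would divide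
  \<open>2 ^ (z + 1)\<close>.\<close>

lemma no_solution_y_eq_z:
  assumes eq: "a ^ x * w + b ^ z = c ^ z" and "z > 0" "x > z"
  shows False
proof (cases "even z")
  case True
  then obtain j where "z = 2 * j" by auto
  then show False
    using pythagorean_no_power_quotient[OF pyth coprime_ab, of j x w] assms a_ge by auto
next
  case False
  have "int a = (int u + 1) * (int u - 1)" by (simp add: int_a power2_eq_square algebra_simps)
  then have ua: "int u + 1 dvd int a" by simp
  also have "int a dvd int a ^ x * int w" using assms by (intro dvd_mult2 dvd_power) auto
  finally have "int u + 1 dvd int a ^ x * int w" .
  moreover have "int c ^ z - int b ^ z = int a ^ x * int w"
    using arg_cong[OF eq, of int] by simp
  ultimately have "[int c ^ z = int b ^ z] (mod int u + 1)" by (simp add: cong_iff_dvd_diff)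
  moreover have "[int c ^ z = 2 ^ z] (mod int u + 1)"
    using ua by (intro cong_pow) (simp add: c_eq cong_iff_dvd_diff)
  moreover have "[int b ^ z = (- 2) ^ z] (mod int u + 1)"
  proof (intro cong_pow)
    have "int b - (- 2) = (int u + 1) * 2" by (simp add: b)
    then show "[int b = - 2] (mod int u + 1)" unfolding cong_iff_dvd_diff by (simp only: dvd_triv_left)
  qed
  ultimately have "[2 ^ z = (- 2) ^ z] (mod int u + 1)" by (meson cong_sym cong_trans)
  then have "int u + 1 dvd 2 ^ (z + 1)" using False by (simp add: cong_iff_dvd_diff)
  moreover have "coprime (int u + 1) (2 ^ (z + 1))" using even_u by simp
  ultimately have "is_unit (int u + 1)" by (metis coprime_absorb_left)
  then show False using u_ge by simp
qed

text \<open>Even \<open>z\<close> is the lifting bound with \<open>a\<close> and \<open>b\<close>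
  exchanged. Odd \<open>z\<close> fails modulo 4, where \<open>a\<close> is \<open>-1\<close> and
  \<open>c\<close> is 1.\<close>

lemma no_solution_x_eq_z:
  assumes eq: "a ^ z + b ^ y * w = c ^ z" and "z > 0" "y > z"
  shows False
proof (cases "even z")
  case True
  then obtain j where "z = 2 * j" by auto
  then show False
    using pythagorean_no_power_quotient[of b a c j y w] coprime_ab pyth assms b_ge
    by (auto simp: coprime_commute add.commute)
next
  case False
  have "4 dvd b ^ y * w"
    using dvd_trans[OF four_dvd_b dvd_power[of y b]] assms by (intro dvd_mult2) auto
  then have "4 dvd int (b ^ y * w)" by presburger
  moreover have "int c ^ z - int a ^ z = int (b ^ y * w)"
    using arg_cong[OF eq, of int] by simp
  ultimately have "[int c ^ z = int a ^ z] (mod 4)" by (simp add: cong_iff_dvd_diff)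
  moreover have "[int a ^ z = (- 1) ^ z] (mod 4)" by (intro cong_pow cong_a_4)
  moreover have "[int c ^ z = 1 ^ z] (mod 4)"
    using cong_a_4 by (intro cong_pow) (simp add: c_eq cong_iff_dvd_diff add.commute)
  ultimately have "[1 ^ z = (- 1) ^ z] (mod (4::int))" by (meson cong_sym cong_trans)
  then show False using False by (simp add: cong_iff_dvd_diff)
qed

section \<open>The case of smallest exponent \<open>z\<close>\<close>

text \<open>Coprime factors of \<open>c ^ z\<close> are themselves \<open>z\<close>-th powers,
  \<open>c1 ^ z\<close> and \<open>c2 ^ z\<close> with \<open>c1 * c2 = c\<close>. Here
  \<open>c1 \<ge> 2\<close> and \<open>c2 \<ge> a\<close>, but
  \<open>2 * a > a + 2 = c\<close>.\<close>

lemma no_power_in_coprime_factorization: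
  assumes "g * h = c ^ z" "coprime g h" "g > 1" "a ^ x \<le> h" "x > z" "z > 0"
  shows False
proof -
  obtain c1 c2 where c12: "g = c1 ^ z" "h = c2 ^ z" "c1 * c2 = c"
    using coprime_mult_eq_powerE assms by metis
  have "a ^ z \<le> a ^ x" using a_ge assms by (intro power_increasing) auto
  also have "\<dots> \<le> c2 ^ z" using c12 assms by simp
  finally have "a \<le> c2" using assms(6) by (simp add: power_mono_iff)
  moreover have "c1 \<ge> 2"
  proof (rule ccontr)
    assume "\<not> c1 \<ge> 2"
    then have "c1 = 0 \<or> c1 = 1" by linarith
    then show False using c12(1) assms(3,6) by (auto simp: power_0_left)
  qed
  ultimately have "2 * a \<le> c" using c12 by (metis mult_le_mono)
  then show False using c_eq a_ge by simp
qed

text \<open>Every prime \<open>p\<close> of \<open>a ^ x + b ^ x\<close> divides \<open>c\<close>,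
  so \<open>a^2\<close> is \<open>-b^2\<close> modulo \<open>p\<close>. This forces
  \<open>x = 2 * j\<close> with \<open>j\<close> odd. Lifting with bases \<open>a^2\<close> and
  \<open>-b^2\<close> then makes \<open>a ^ x + b ^ x\<close> divide \<open>(a^2 + b^2) * j\<close>,
  which is too small unless \<open>j = 1\<close>.\<close>

lemma no_solution_common_factor:
  assumes eq: "n ^ d * (a ^ x + b ^ x) = c ^ z" and "x > z" "z > 0"
  shows False
proof -
  let ?D = "a ^ x + b ^ x"
  have "x < 2 ^ x" by (rule less_exp)
  also have "2 ^ x \<le> a ^ x" using a_ge by (intro power_mono) auto
  finally have D1: "?D > 1" using assms by simp
  have prime_dvd_c: "p dvd c" if "prime p" "p dvd ?D" for p
    using that prime_dvd_power[of p c z] by (metis eq dvd_mult)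
  have not_dvd_b: "\<not> int p dvd (int b) ^ i" if "prime p" "p dvd ?D" for p i
  proof
    assume "int p dvd (int b) ^ i"
    then have "p dvd b" using that(1) prime_dvd_power[of "int p" "int b" i] by simp
    then show False using prime_dvd_c[OF that] that(1) coprime_bc
      by (meson coprime_common_divisor not_prime_unit)
  qed
  have odd_p: "odd p" if "prime p" "p dvd ?D" for p
    using prime_dvd_c[OF that] odd_c dvd_trans by blast
  have cong_sq: "[(int a)\<^sup>2 = - ((int b)\<^sup>2)] (mod int p)" if "prime p" "p dvd ?D" for p
  proof -
    have "int p dvd (int c)\<^sup>2" using prime_dvd_c[OF that] by (simp add: power2_eq_square)
    moreover have "(int a)\<^sup>2 - - ((int b)\<^sup>2) = (int c)\<^sup>2"
      using arg_cong[OF pyth, of int] by simp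
    ultimately show ?thesis by (simp only: cong_iff_dvd_diff)
  qed
  have two_b: False if "prime p" "p dvd ?D" "int p dvd 2 * (int b) ^ i" for p i
  proof -
    have "int p dvd 2" using that not_dvd_b by (metis prime_dvd_mult_iff prime_nat_int_transfer)
    then have "p dvd 2" by presburger
    then have "p = 2" using that(1) by (simp add: primes_dvd_imp_eq)
    then show False using odd_p[OF that(1,2)] by simp
  qed
  obtain p where p: "prime p" "p dvd ?D" using prime_factor_nat[of ?D] D1 by auto
  have ab: "[(int a) ^ x = - ((int b) ^ x)] (mod int p)"
  proof -
    have "int p dvd int ?D" using p(2) by (simp only: int_dvd_int_iff)
    then show ?thesis by (simp add: cong_iff_dvd_diff)
  qed
  have "even x"
  \<comment> \<open>For odd \<open>x\<close>, squaring \<open>a ^ x = - b ^ x\<close> gives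
    \<open>b ^ (2 * x)\<close>, while raising \<open>a^2 = - b^2\<close> to the power
    \<open>x\<close> gives \<open>- b ^ (2 * x)\<close>.\<close>
  proof (rule ccontr)
    assume x: "odd x"
    have "[((int a) ^ x)\<^sup>2 = (- ((int b) ^ x))\<^sup>2] (mod int p)" using ab by (rule cong_pow)
    moreover have "[((int a)\<^sup>2) ^ x = (- ((int b)\<^sup>2)) ^ x] (mod int p)"
      using cong_sq[OF p] by (rule cong_pow)
    then have "[((int a) ^ x)\<^sup>2 = - (((int b) ^ x)\<^sup>2)] (mod int p)"
      using x by (simp add: power_minus_odd power_mult[symmetric] mult.commute[of x 2])
    ultimately have "[(- ((int b) ^ x))\<^sup>2 = - (((int b) ^ x)\<^sup>2)] (mod int p)"
      by (meson cong_sym cong_trans)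
    then have "int p dvd 2 * (int b) ^ (2 * x)"
      unfolding cong_iff_dvd_diff by (simp add: mult.commute[of 2 x] power_mult)
    then show False using two_b p by blast
  qed
  then obtain j where j: "x = 2 * j" by auto
  have "odd j"
  proof (rule ccontr)
    assume "\<not> odd j"
    have "[((int a)\<^sup>2) ^ j = (- ((int b)\<^sup>2)) ^ j] (mod int p)"
      using cong_sq[OF p] by (rule cong_pow)
    then have "[(int a) ^ x = (int b) ^ x] (mod int p)"
      using \<open>\<not> odd j\<close> by (simp add: j power_mult)
    then have "[(int b) ^ x = - ((int b) ^ x)] (mod int p)" using ab by (meson cong_sym cong_trans)
    then have "int p dvd 2 * (int b) ^ x" by (simp add: cong_iff_dvd_diff)
    then show False using two_b p by blast
  qed
  have sq_diff: "(int a)\<^sup>2 - - ((int b)\<^sup>2) = int (a\<^sup>2 + b\<^sup>2)" by simp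
  have "int ?D dvd ((int a)\<^sup>2 - - ((int b)\<^sup>2)) * int j"
  proof (rule dvd_diff_powers)
    show "j > 0" "?D > 0" using D1 odd_pos[OF \<open>odd j\<close>] by linarith+
    show "int ?D dvd ((int a)\<^sup>2) ^ j - (- ((int b)\<^sup>2)) ^ j"
      using \<open>odd j\<close> by (simp add: j power_mult)
    show "int q dvd (int a)\<^sup>2 - - ((int b)\<^sup>2) \<and> \<not> int q dvd - ((int b)\<^sup>2)
        \<and> (q = 2 \<longrightarrow> 4 dvd (int a)\<^sup>2 - - ((int b)\<^sup>2))" if "prime q" "q dvd ?D" for q
      using cong_sq[OF that] not_dvd_b[OF that] odd_p[OF that] by (auto simp: cong_iff_dvd_diff)
  qed
  then have "?D dvd (a\<^sup>2 + b\<^sup>2) * j" by (simp only: sq_diff of_nat_mult[symmetric] int_dvd_int_iff)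
  moreover have "(a\<^sup>2 + b\<^sup>2) * j > 0" using odd_pos[OF \<open>odd j\<close>] a_ge by simp
  ultimately have le: "?D \<le> (a\<^sup>2 + b\<^sup>2) * j" by (simp only: dvd_imp_le)
  obtain i where i: "j = Suc i" using \<open>odd j\<close> by (cases j) auto
  have "i = 0"
  proof (rule ccontr)
    assume i0: "i \<noteq> 0"
    have gt: "s\<^sup>2 * j < s ^ x" if "s \<ge> 2" for s :: nat
    proof -
      have "j < 2 * 2 ^ i" using less_exp[of i] i0 i by linarith
      also have "\<dots> \<le> 4 ^ i" using i0 by (cases i) (auto simp: power_mono)
      also have "\<dots> \<le> (s\<^sup>2) ^ i" using that power_mono[of 2 s 2] by (intro power_mono) auto
      finally have "j < (s\<^sup>2) ^ i" .
      then have "s\<^sup>2 * j < s\<^sup>2 * (s\<^sup>2) ^ i" using that by simp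
      also have "s\<^sup>2 * (s\<^sup>2) ^ i = s ^ x" by (simp only: i j power_mult power_Suc)
      finally show ?thesis .
    qed
    show False using gt[of a] gt[of b] le a_ge b_ge by (simp add: distrib_right)
  qed
  then have x2: "x = 2" using i j by simp
  then have "z = 1" using assms by simp
  have "n ^ d * ?D > 0" unfolding eq c_eq by simp
  then have "n ^ d \<noteq> 0" by (intro notI) simp
  then have "n ^ d \<ge> 1" by linarith
  then have "1 * c\<^sup>2 \<le> n ^ d * c\<^sup>2" by (rule mult_le_mono1)
  also have "\<dots> = c" using eq x2 \<open>z = 1\<close> pyth by simp
  finally show False using c_eq by (simp add: power2_eq_square)
qed

text \<open>Primes of \<open>n\<close> divide \<open>c\<close>, so \<open>n\<close> is coprime to
  \<open>a\<close> and \<open>b\<close>. If \<open>x \<noteq> y\<close>, extracting the lower power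
  of \<open>n\<close> splits \<open>c ^ z\<close> into coprime factors, the second one at least
  \<open>a ^ x\<close>.\<close>

lemma no_solution_z_min:
  assumes eq: "a ^ x * n ^ (x - z) + b ^ y * n ^ (y - z) = c ^ z"
    and n: "n > 1" and z: "z > 0" "z < x" "z < y"
  shows False
proof -
  have "n dvd a ^ x * n ^ (x - z) + b ^ y * n ^ (y - z)"
    using z by (intro dvd_add dvd_mult dvd_power) auto
  then have prime_dvd_c: "p dvd c" if "prime p" "p dvd n" for p
    using that eq prime_dvd_power[of p c z] dvd_trans[of p n] by metis
  have coprime_n: "coprime (n ^ i) (r ^ j + n ^ Suc l * t)" if "coprime n r" for i j l r t
  proof -
    have "gcd n (r ^ j + n * (n ^ l * t)) = gcd n (r ^ j)"
      using gcd_add_mult[of n "n ^ l * t" "r ^ j"] by (simp only: add.commute mult.commute)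
    also have "\<dots> = 1" using that by simp
    finally have "coprime n (r ^ j + n * (n ^ l * t))" by (rule gcd_eq_1_imp_coprime)
    then show ?thesis by (simp add: mult.assoc)
  qed
  have n_a: "coprime n a" and n_b: "coprime n b"
  proof -
    have "coprime n r" if "coprime r c" for r
    proof (rule ccontr)
      assume "\<not> coprime n r"
      then have "gcd n r \<noteq> 1" by (simp only: coprime_iff_gcd_eq_1 not_False_eq_True)
      then obtain p where "prime p" "p dvd gcd n r" using prime_factor_nat by blast
      then show False using prime_dvd_c[of p] that
        by (meson coprime_common_divisor dvd_trans gcd_dvd1 gcd_dvd2 not_prime_unit)
    qed
    then show "coprime n a" "coprime n b" using coprime_ac coprime_bc by auto
  qed
  consider "x = y" | "x < y" | "y < x" by linarith
  then show False
  proof cases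
    case 1
    then show False using no_solution_common_factor[of n "x - z" x z] eq z by (simp add: algebra_simps)
  next
    case 2
    \<comment> \<open>\<open>Suc l\<close> is the power of \<open>n\<close> left on the other term;
      being positive, it keeps the second factor coprime to \<open>n\<close>.\<close>
    define l where "l = y - x - 1"
    then have l: "y - z = (x - z) + Suc l" using z \<open>x < y\<close> by simp
    show False
    proof (rule no_power_in_coprime_factorization)
      show "n ^ (x - z) * (a ^ x + n ^ Suc l * b ^ y) = c ^ z"
        using eq by (simp add: l power_add algebra_simps)
      show "coprime (n ^ (x - z)) (a ^ x + n ^ Suc l * b ^ y)" by (rule coprime_n[OF n_a])
    qed (use n z in \<open>auto intro: one_less_power simp del: One_nat_def\<close>)
  next
    case 3
    define l where "l = x - y - 1"
    then have l: "x - z = (y - z) + Suc l" using z \<open>y < x\<close> by simp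
    show False
    proof (rule no_power_in_coprime_factorization)
      show "n ^ (y - z) * (b ^ y + n ^ Suc l * a ^ x) = c ^ z"
        using eq by (simp add: l power_add algebra_simps)
      show "coprime (n ^ (y - z)) (b ^ y + n ^ Suc l * a ^ x)" by (rule coprime_n[OF n_b])
      have "1 * a ^ x \<le> n ^ Suc l * a ^ x" using n by (intro mult_le_mono1) simp
      then show "a ^ x \<le> b ^ y + n ^ Suc l * a ^ x" by linarith
    qed (use n z in \<open>auto intro: one_less_power simp del: One_nat_def\<close>)
  qed
qed

section \<open>The case \<open>y < z < x\<close>\<close>

lemma even_if_cong_two_power:
  assumes "[2 ^ z = 1] (mod (3::nat))"
  shows "even z"
proof (rule ccontr)
  assume "odd z"
  then obtain j where "z = 2 * j + 1" using oddE by blast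
  then have "(2::nat) ^ z = 2 * 4 ^ j" by (simp add: power_mult)
  moreover have "[2 * 4 ^ j = 2 * 1 ^ j] (mod (3::nat))"
    by (intro cong_mult cong_pow) (simp_all add: cong_def)
  ultimately show False using assms by (simp add: cong_def)
qed

text \<open>Modulo \<open>a\<close> the base \<open>c\<close> is 2, so
  \<open>a dvd 2 ^ z - 1\<close>; as \<open>3 dvd a\<close>, this gives \<open>z = 2 * j\<close>,
  and by size \<open>u^2 \<le> 4 ^ j\<close>. Lifting at the prime 3 for \<open>c^2\<close> yields
  \<open>3 ^ x dvd (u^2 + 2) * j\<close>, whose right side is at most
  \<open>2 * 8 ^ j < 3 ^ (2 * j + 1)\<close>.\<close>

lemma no_solution_power_minus_one:
  assumes eq: "a ^ x * w + 1 = c ^ z" and z: "0 < z" "z < x"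
  shows False
proof -
  have "a dvd a ^ x * w" using z by (intro dvd_mult2 dvd_power) auto
  then have "[c ^ z = 1] (mod a)" using cong_add[of "a ^ x * w" 0 a 1 1] unfolding eq[symmetric]
    by (simp add: cong_0_iff)
  then have two: "[2 ^ z = 1] (mod a)" using cong_c_2[of a z] by (meson cong_sym cong_trans dvd_refl)
  then have "[2 ^ z = (1::nat)] (mod 3)" using three_dvd_a by (rule cong_dvd_modulus_nat)
  then obtain j where j: "z = 2 * j" using even_if_cong_two_power by blast
  have "a dvd 2 ^ z - 1"
    using two cong_altdef_nat[of 1 "2 ^ z" a] by simp
  then have "a \<le> 2 ^ z - 1" using z one_less_power[of "2::nat" z] by (intro dvd_imp_le) auto
  then have u_le: "u\<^sup>2 \<le> 4 ^ j" using a less_exp[of z] by (simp add: j power_mult)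
  have c3: "(int c)\<^sup>2 - 1 = (int u)\<^sup>2 * ((int u)\<^sup>2 + 2)"
    by (simp add: int_c algebra_simps power2_eq_square)
  have "3 dvd int a" using three_dvd_a by presburger
  then have "3 dvd (int u)\<^sup>2 + 2" using int_a by presburger
  then have d3: "3 dvd (int c)\<^sup>2 - 1" by (simp add: c3)
  have "int (3 ^ x) dvd ((int c)\<^sup>2 - 1) * int j"
  proof (rule dvd_diff_powers)
    show "j > 0" "(3::nat) ^ x > 0" using j z by simp_all
    have "3 ^ x dvd a ^ x * w" using three_dvd_a by (intro dvd_mult2 dvd_power_same)
    then have "int (3 ^ x) dvd int (a ^ x * w)" by (simp only: int_dvd_int_iff)
    moreover have "((int c)\<^sup>2) ^ j - 1 ^ j = int (a ^ x * w)"
      using arg_cong[OF eq, of int] by (simp add: j power_mult)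
    ultimately show "int (3 ^ x) dvd ((int c)\<^sup>2) ^ j - 1 ^ j" by (simp only:)
    fix p :: nat assume "prime p" "p dvd 3 ^ x"
    then have "p dvd 3" using prime_dvd_power by blast
    then have "p = 3" using \<open>prime p\<close> by (simp add: primes_dvd_imp_eq)
    then show "int p dvd (int c)\<^sup>2 - 1 \<and> \<not> int p dvd 1 \<and> (p = 2 \<longrightarrow> 4 dvd (int c)\<^sup>2 - 1)"
      using d3 by simp
  qed
  then have "3 ^ x dvd (int u)\<^sup>2 * (((int u)\<^sup>2 + 2) * int j)" by (simp add: c3 mult.assoc)
  moreover have "coprime 3 u" using coprime_au three_dvd_a by (meson coprime_divisors dvd_refl)
  then have "coprime (3 ^ x) ((int u)\<^sup>2)" using coprime_int_iff[of "3" u] by simp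
  ultimately have "3 ^ x dvd ((int u)\<^sup>2 + 2) * int j" by (simp add: coprime_dvd_mult_right_iff)
  then have "int (3 ^ x) dvd int ((u\<^sup>2 + 2) * j)" by (simp add: algebra_simps)
  then have "3 ^ x dvd (u\<^sup>2 + 2) * j" by (simp only: int_dvd_int_iff)
  then have "3 ^ x \<le> (u\<^sup>2 + 2) * j" using j z by (intro dvd_imp_le) auto
  also have "\<dots> \<le> (2 * 4 ^ j) * 2 ^ j"
  proof (rule mult_le_mono)
    have "4 ^ 1 \<le> (4::nat) ^ j" using j z by (intro power_increasing) auto
    then show "u\<^sup>2 + 2 \<le> 2 * 4 ^ j" using u_le by simp
    show "j \<le> 2 ^ j" using less_exp[of j] by simp
  qed
  also have "\<dots> = 2 * 8 ^ j" by (simp add: power_mult_distrib[symmetric])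
  also have "\<dots> < 3 * 9 ^ j" using power_mono[of 8 "9::nat" j] by (simp add: less_le_trans[of _ "3 * 8 ^ j"])
  also have "\<dots> = 3 ^ (2 * j + 1)" by (simp add: power_mult)
  also have "\<dots> \<le> 3 ^ x" using j z by (intro power_increasing) auto
  finally show False by simp
qed

lemma dvd_b_power_odd: "L dvd b ^ y \<Longrightarrow> odd L \<Longrightarrow> L = 1"
proof -
  assume L: "L dvd b ^ y" "odd L"
  have "coprime L (b ^ y)" using L(2) by (simp add: b_eq)
  then show "L = 1" using L(1) by (metis coprime_absorb_left nat_dvd_1_iff_1)
qed

text \<open>\<open>n ^ (z - y)\<close> divides the power of two \<open>b ^ y\<close>, so
  \<open>n\<close> is even. By parity the complementary divisor \<open>L\<close> is odd, hence 1,
  which reduces to the preceding equation.\<close>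

lemma no_solution_y_lt_z_lt_x:
  assumes eq: "a ^ x * n ^ (x - y) + b ^ y = c ^ z * n ^ (z - y)"
    and n: "n > 1" and yz: "0 < y" "y < z" "z < x"
  shows False
proof -
  have e: "x - y = (x - z) + (z - y)" using yz by simp
  have "n ^ (z - y) dvd b ^ y"
  proof -
    have "n ^ (z - y) dvd a ^ x * n ^ (x - y) + b ^ y" unfolding eq by simp
    moreover have "n ^ (z - y) dvd a ^ x * n ^ (x - y)" by (simp add: e power_add)
    ultimately show ?thesis by (simp only: dvd_add_right_iff)
  qed
  then obtain L where L: "b ^ y = n ^ (z - y) * L" by auto
  have "n ^ (z - y) * (a ^ x * n ^ (x - z) + L) = n ^ (z - y) * c ^ z"
    using eq by (simp add: e power_add L algebra_simps)
  then have eq': "a ^ x * n ^ (x - z) + L = c ^ z" using n by simp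
  have "n dvd n ^ (z - y)" using yz by (intro dvd_power) auto
  then have "n dvd b ^ y" using \<open>n ^ (z - y) dvd b ^ y\<close> dvd_trans by blast
  then have "even n" using dvd_b_power_odd[of n y] n by auto
  then have "even (a ^ x * n ^ (x - z))" using yz by simp
  moreover have "odd (c ^ z)" using odd_c by simp
  ultimately have "odd L" using eq' by (metis even_add)
  then have "L = 1" using dvd_b_power_odd[of L y] L by simp
  then show False using no_solution_power_minus_one[of x "n ^ (x - z)" z] eq' yz by simp
qed

section \<open>The case \<open>x < z < y\<close>\<close>

text \<open>Lifting at 2 puts \<open>2 ^ (2 * m)\<close> into \<open>(a1^2 - 1) * j\<close> with
  \<open>x = 2 * j\<close>. At most \<open>m + 1\<close> of these factors 2 lie in
  \<open>a1^2 - 1\<close>, so at least \<open>m - 1\<close> lie in \<open>j\<close>.\<close>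

lemma two_pow_m_dvd_exponent:
  assumes a12: "a1 * a2 = a" and gt: "a1 > 1" "a2 > 1" and x: "even x" "x > 0"
    and cong: "[int a1 ^ x = 1] (mod (int u)\<^sup>2)"
  shows "2 ^ m dvd x"
proof -
  have "odd a1" using a12 odd_a by auto
  obtain j where j: "x = 2 * j" "j > 0" using x by auto
  let ?P = "int a1 - 1" and ?Q = "int a1 + 1"
  have PQ: "(int a1)\<^sup>2 - 1 = ?P * ?Q" by (simp add: power2_eq_square algebra_simps)
  have even_PQ: "even ?P" "even ?Q" using \<open>odd a1\<close> by auto
  have four: "4 dvd (int a1)\<^sup>2 - 1" unfolding PQ using mult_dvd_mono[OF even_PQ] by simp
  have uu: "(int u)\<^sup>2 = 2 ^ (2 * m)" using arg_cong[OF u_sq, of int] by simp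
  have "int (2 ^ (2 * m)) dvd ((int a1)\<^sup>2 - 1) * int j"
  proof (rule dvd_diff_powers)
    show "j > 0" "(2::nat) ^ (2 * m) > 0" using j by simp_all
    show "int (2 ^ (2 * m)) dvd ((int a1)\<^sup>2) ^ j - 1 ^ j"
      using cong by (simp add: cong_iff_dvd_diff uu j(1) power_mult)
    fix p :: nat assume "prime p" "p dvd 2 ^ (2 * m)"
    then have "p dvd 2" using prime_dvd_power by blast
    then have "p = 2" using \<open>prime p\<close> by (simp add: primes_dvd_imp_eq)
    then show "int p dvd (int a1)\<^sup>2 - 1 \<and> \<not> int p dvd 1 \<and> (p = 2 \<longrightarrow> 4 dvd (int a1)\<^sup>2 - 1)"
      using four even_PQ by (simp add: PQ)
  qed
  moreover have "2 * m = (m + 1) + (m - 1)" using m_pos by simp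
  ultimately have "2 ^ ((m + 1) + (m - 1)) dvd ((int a1)\<^sup>2 - 1) * int j" by (metis of_nat_numeral of_nat_power)
  moreover have "\<not> 2 ^ Suc (m + 1) dvd (int a1)\<^sup>2 - 1"
  proof
    let ?U = "2 ^ (m + 1) :: int"
    assume "2 ^ Suc (m + 1) dvd (int a1)\<^sup>2 - 1"
    then have d: "2 ^ (m + 2) dvd ?P * ?Q" by (simp add: PQ)
    \<comment> \<open>\<open>a1 - 1\<close> and \<open>a1 + 1\<close> differ by 2, so one of them
      takes all but one of the factors 2.\<close>
    have "?U dvd ?P \<or> ?U dvd ?Q"
    proof (rule disjCI)
      assume "\<not> ?U dvd ?Q"
      then have "2\<^sup>2 dvd ?P"
        using d prime_power_add_dvd_mult[of 2 m 2 ?Q ?P] gt by (simp add: mult.commute)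
      then have "\<not> 2 ^ Suc 1 dvd ?Q" by (simp add: numeral_2_eq_2[symmetric]) presburger
      then show "?U dvd ?P"
        using d prime_power_add_dvd_mult[of 2 1 "m + 1" ?Q ?P] gt by (simp add: mult.commute)
    qed
    moreover have "?U dvd int a1 * int a2 + 1"
    proof -
      have "int a1 * int a2 + 1 = int (u\<^sup>2)" using a a12 by (metis of_nat_1 of_nat_add of_nat_mult)
      also have "\<dots> = 2 ^ (2 * m)" using uu by simp
      also have "?U dvd 2 ^ (2 * m)" using m_pos by (intro le_imp_power_dvd) simp
      finally show ?thesis .
    qed
    \<comment> \<open>\<open>a1 * a2\<close> is \<open>-1\<close> modulo \<open>U = 2 * u\<close>,
      so \<open>a1\<close> and \<open>a2\<close> are 1 and \<open>-1\<close> in some order. Both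
      exceed 1, hence their product is at least \<open>U^2 - 1\<close>, more than
      \<open>a = u^2 - 1\<close>.\<close>
    ultimately have "?U dvd ?P \<and> ?U dvd int a2 + 1 \<or> ?U dvd ?Q \<and> ?U dvd int a2 - 1"
    proof (elim disjE)
      assume U: "?U dvd int a1 * int a2 + 1" "?U dvd ?P"
      then have "?U dvd (int a1 * int a2 + 1) - ?P * int a2" by (intro dvd_diff dvd_mult2[OF U(2)])
      also have "(int a1 * int a2 + 1) - ?P * int a2 = int a2 + 1" by (simp add: algebra_simps)
      finally show ?thesis using U by simp
    next
      assume U: "?U dvd int a1 * int a2 + 1" "?U dvd ?Q"
      then have "?U dvd ?Q * int a2 - (int a1 * int a2 + 1)" by (intro dvd_diff dvd_mult2[OF U(2)])
      also have "?Q * int a2 - (int a1 * int a2 + 1) = int a2 - 1" by (simp add: algebra_simps)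
      finally show ?thesis using U by simp
    qed
    then have "(?U + 1 \<le> int a1 \<and> ?U - 1 \<le> int a2) \<or> (?U - 1 \<le> int a1 \<and> ?U + 1 \<le> int a2)"
      using gt zdvd_imp_le[of ?U ?P] zdvd_imp_le[of ?U ?Q]
        zdvd_imp_le[of ?U "int a2 + 1"] zdvd_imp_le[of ?U "int a2 - 1"] by linarith
    moreover have "?U > 1" using one_less_power[of "2::int" "m + 1"] by simp
    ultimately have "(?U + 1) * (?U - 1) \<le> int a1 * int a2"
      using mult_mono[of "?U + 1" "int a1" "?U - 1" "int a2"]
        mult_mono[of "?U - 1" "int a1" "?U + 1" "int a2"] by (auto simp: mult.commute)
    also have "\<dots> = int a" using a12 by (metis of_nat_mult)
    also have "\<dots> = (int u)\<^sup>2 - 1" by (rule int_a)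
    finally have "?U\<^sup>2 \<le> (int u)\<^sup>2" by (simp add: algebra_simps power2_eq_square)
    moreover have "?U = 2 * int u" by (simp add: u)
    ultimately have "(2 * int u)\<^sup>2 \<le> (int u)\<^sup>2" by (simp only:)
    then show False using u_ge by (simp add: power_mult_distrib)
  qed
  ultimately have "2 ^ (m - 1) dvd int j"
    using prime_power_add_dvd_mult[of 2 "m + 1" "m - 1" "(int a1)\<^sup>2 - 1" "int j"] j by simp
  then have "int (2 ^ (m - 1)) dvd int j" by simp
  then have "2 ^ (m - 1) dvd j" by (simp only: int_dvd_int_iff)
  then have "2 * 2 ^ (m - 1) dvd 2 * j" by simp
  moreover have "2 * 2 ^ (m - 1) = (2::nat) ^ m" using m_pos by (cases m) auto
  ultimately show ?thesis unfolding j(1) by (simp only:)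
qed

text \<open>Write \<open>p - 1 = 2 ^ f * q\<close> with \<open>q\<close> odd. If
  \<open>f \<le> m\<close>, then \<open>p - 1\<close> divides \<open>x * q\<close>, and Fermat's
  little theorem gives \<open>2 ^ (z * q) = 1\<close> modulo \<open>p\<close>; for odd
  \<open>z\<close> this contradicts the even order of 2. If \<open>f > m\<close>, then
  \<open>2 * u dvd p - 1\<close>, but \<open>p\<close> divides \<open>(u - 1) * (u + 1)\<close> and
  so is at most \<open>u + 1\<close>.\<close>

lemma even_exponent_if_cong:
  assumes p: "prime p" "p dvd a" and s: "[s ^ x = 2 ^ z] (mod p)" and x: "2 ^ m dvd x"
  shows "even z"
proof (rule ccontr)
  assume z: "odd z"
  have "odd p" using p(2) odd_a dvd_trans by blast
  have p2: "coprime p 2" using \<open>odd p\<close> by simp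
  have ordk: "ord p 2 dvd 2 ^ k"
  proof -
    have "[a + 1 = 0 + 1] (mod p)" using p(2) by (intro cong_add) (simp_all add: cong_0_iff)
    then have "[2 ^ (2 ^ k) = 1] (mod p)" by (simp only: a u_sq m add_0)
    then show ?thesis by (simp only: ord_divides)
  qed
  have ord1: "\<not> ord p 2 dvd q" if "odd q" for q
  proof
    assume q: "ord p 2 dvd q"
    have "coprime q (2 ^ k)" using that by simp
    then have "ord p 2 = 1" using q ordk by (metis coprime_common_divisor nat_dvd_1_iff_1)
    then have "[2 ^ 1 = 1] (mod p)" by (simp only: ord_divides dvd_refl)
    then have "[int 2 = int 1] (mod int p)" by (simp only: cong_int_iff power_one_right)
    then have "int p dvd 1" by (simp add: cong_iff_dvd_diff)
    then show False using p(1) by simp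
  qed
  have p1: "p - 1 \<noteq> 0" using prime_gt_1_nat[OF p(1)] by simp
  obtain q where q: "p - 1 = 2 ^ multiplicity 2 (p - 1) * q" "odd q"
    using multiplicity_decompose'[of "p - 1" 2] p1 by auto
  let ?f = "multiplicity 2 (p - 1)"
  have "m < ?f"
  proof (rule ccontr)
    assume "\<not> m < ?f"
    then have "2 ^ ?f dvd (2::nat) ^ m" by (intro le_imp_power_dvd) simp
    then have "2 ^ ?f dvd x" using x dvd_trans by blast
    then have "p - 1 dvd x * q" using q(1) by (metis dvd_refl mult_dvd_mono)
    then obtain v where v: "x * q = (p - 1) * v" by auto
    \<comment> \<open>\<open>x = 0\<close> is allowed here, so \<open>p dvd s\<close> does not at
      once give \<open>p dvd 2 ^ z\<close>; in that case \<open>2 ^ z = 1\<close> modulo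
      \<open>p\<close> contradicts the order directly.\<close>
    have "\<not> p dvd s"
    proof
      assume "p dvd s"
      moreover have "x > 0 \<or> x = 0" by auto
      ultimately have "p dvd s ^ x \<or> x = 0" by (metis dvd_power dvd_trans)
      moreover have "\<not> p dvd 2 ^ z"
        using p2 p(1) prime_dvd_power[of p 2 z] by (metis coprime_absorb_left not_prime_unit)
      ultimately have "x = 0" using s by (metis cong_dvd_iff)
      then have "[2 ^ z = 1] (mod p)" using s by (simp add: cong_sym_eq)
      then have "ord p 2 dvd z" by (simp only: ord_divides)
      then show False using ord1 z by blast
    qed
    then have "[(s ^ (p - 1)) ^ v = 1 ^ v] (mod p)"
      using p(1) by (intro cong_pow fermat_theorem)
    then have "[(s ^ x) ^ q = 1] (mod p)" by (simp add: power_mult[symmetric] v)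
    moreover have "[(s ^ x) ^ q = (2 ^ z) ^ q] (mod p)" using s by (rule cong_pow)
    ultimately have "[2 ^ (z * q) = 1] (mod p)" by (metis cong_sym cong_trans power_mult)
    then have "ord p 2 dvd z * q" by (simp only: ord_divides)
    then show False using ord1[of "z * q"] z q by simp
  qed
  then have "2 ^ Suc m dvd (2::nat) ^ ?f" by (intro le_imp_power_dvd) simp
  then have "2 * u dvd p - 1" using q(1) by (metis u dvd_mult2 power_Suc)
  then have "2 * u \<le> p - 1" using p1 by (intro dvd_imp_le) auto
  moreover have "p \<le> u + 1"
  proof -
    have "a = (u - 1) * (u + 1)" using a by (simp add: algebra_simps power2_eq_square)
    then have "p dvd u - 1 \<or> p dvd u + 1" using p by (metis prime_dvd_mult_iff)
    then have "p \<le> u - 1 \<or> p \<le> u + 1" using u_ge by (auto dest!: dvd_imp_le)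
    then show ?thesis by linarith
  qed
  ultimately show False using u_ge by linarith
qed

lemma cong_u_sq_if_sum:
  assumes eq: "s + b ^ y * w = c ^ z" and y: "y \<ge> 2"
  shows "[int s = 1] (mod (int u)\<^sup>2)"
proof -
  have "u\<^sup>2 dvd b ^ y * w" using two_u_sq_dvd[OF y] by (metis dvd_mult2 dvd_mult_right)
  then have "(int u)\<^sup>2 dvd int (b ^ y * w)" by (metis int_dvd_int_iff of_nat_power)
  moreover have "int c ^ z - int s = int (b ^ y * w)" using arg_cong[OF eq, of int] by simp
  ultimately have "[int c ^ z = int s] (mod (int u)\<^sup>2)" by (simp only: cong_iff_dvd_diff)
  moreover have "[int c ^ z = 1 ^ z] (mod (int u)\<^sup>2)"
    by (intro cong_pow) (simp add: int_c cong_iff_dvd_diff)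
  ultimately show ?thesis by (metis cong_sym cong_trans power_one)
qed

text \<open>With \<open>C = c ^ j\<close>, the product \<open>(C - s) * (C + s)\<close> is divisible
  by the power of two \<open>b ^ y\<close>. As \<open>s\<close> is odd, 4 cannot divide both
  factors, so one of them is divisible by half of \<open>b ^ y\<close>. Hence
  \<open>b ^ y < 4 * C\<close>, while \<open>c \<le> b^2\<close> and \<open>y > 2 * j\<close> give
  \<open>4 * C \<le> b ^ y\<close>.\<close>

lemma no_square_plus_power:
  assumes eq: "s\<^sup>2 + b ^ y * w = c ^ (2 * j)" and "odd s" "y > 2 * j" "j > 0" "w > 0"
  shows False
proof -
  let ?C = "c ^ j"
  have "(m + 1) * y > 0" using assms by simp
  then obtain M where M: "(m + 1) * y = Suc M" using gr0_implies_Suc by blast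
  have bM: "b ^ y = 2 ^ Suc M" by (simp only: b_eq power_mult[symmetric] M)
  have eq': "?C\<^sup>2 = s\<^sup>2 + b ^ y * w" using eq by (simp only: power_mult[symmetric] mult.commute)
  moreover have "b ^ y * w > 0" using b_ge assms(5) by simp
  ultimately have "s\<^sup>2 < ?C\<^sup>2" by linarith
  then have sC: "s < ?C" by (rule power_less_imp_less_base) simp
  obtain e where e: "?C = s + e" using le_Suc_ex[OF less_imp_le[OF sC]] by blast
  have "(?C - s) * (?C + s) = b ^ y * w"
    using eq' unfolding e by (simp add: algebra_simps power2_eq_square)
  then have d: "2 ^ (1 + M) dvd (?C - s) * (?C + s)" by (simp add: bM)
  have pos: "?C - s \<noteq> 0" "?C + s \<noteq> 0" using sC by auto
  have le: "2 ^ M \<le> ?C + s"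
  proof (cases "2 ^ Suc 1 dvd ?C - s")
    case False
    then have "2 ^ M dvd ?C + s"
      using d prime_power_add_dvd_mult[of 2 1 M "?C - s" "?C + s"] pos by simp
    then show ?thesis using pos by (intro dvd_imp_le) auto
  next
    case True
    then have "4 dvd ?C - s" by simp
    then have "\<not> 4 dvd ?C + s" using \<open>odd s\<close> sC by presburger
    then have "\<not> 2 ^ Suc 1 dvd ?C + s" by simp
    then have "2 ^ M dvd ?C - s"
      using d prime_power_add_dvd_mult[of 2 1 M "?C + s" "?C - s"] pos by (simp add: mult.commute)
    then have "2 ^ M \<le> ?C - s" using pos by (intro dvd_imp_le) auto
    then show ?thesis by simp
  qed
  have "b ^ y = 2 * 2 ^ M" by (simp add: bM)
  then have "b ^ y < 4 * ?C" using le sC by linarith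
  also have "4 * ?C \<le> b * (b\<^sup>2) ^ j"
  proof (rule mult_le_mono[OF b_ge power_mono])
    show "c \<le> b\<^sup>2" using u_sq_ge by (simp add: b c power_mult_distrib)
  qed simp
  also have "\<dots> = b ^ Suc (2 * j)" by (simp add: power_mult)
  also have "\<dots> \<le> b ^ y" using assms b_ge by (intro power_increasing) auto
  finally show False by simp
qed

lemma no_solution_factored:
  assumes a12: "a1 * a2 = a" "a2 > 1" and eq: "a1 ^ x + b ^ y * w = c ^ z"
    and xyz: "0 < x" "x < z" "z < y" and w: "w > 0" "\<And>p. prime p \<Longrightarrow> p dvd a2 \<Longrightarrow> p dvd w"
  shows False
proof -
  have cong: "[int (a1 ^ x) = 1] (mod (int u)\<^sup>2)" using cong_u_sq_if_sum[OF eq] xyz by simp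
  have "a1 > 0" using a12 a_ge by (cases a1) auto
  \<comment> \<open>For \<open>a1 = 1\<close> the exponent is immaterial and \<open>2 ^ m\<close>
    serves. Otherwise \<open>x\<close> itself works: an odd \<open>x\<close> would give
    \<open>a1 = 1\<close> modulo \<open>u^2\<close>, impossible for
    \<open>1 < a1 \<le> a < u^2\<close>.\<close>
  have "\<exists>x'. a1 ^ x' = a1 ^ x \<and> 2 ^ m dvd x'"
  proof (cases "a1 = 1")
    case False
    have "even x"
    proof (rule ccontr)
      assume "odd x"
      have uu: "(int u)\<^sup>2 = 2 ^ (2 * m)" using arg_cong[OF u_sq, of int] by simp
      have "[int a1 ^ x = 1] (mod 2 ^ (2 * m))" using cong by (simp only: uu of_nat_power)
      then have "[int a1 = 1] (mod 2 ^ (2 * m))"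
        by (rule pow_cong_one_odd_exponent[OF \<open>odd x\<close>]) (use m_pos in simp)
      then have "(int u)\<^sup>2 dvd int a1 - 1" by (simp add: cong_iff_dvd_diff uu)
      then have "(int u)\<^sup>2 \<le> int a1 - 1" using False \<open>a1 > 0\<close> by (intro zdvd_imp_le) auto
      moreover have "a1 \<le> a" using a12 a_ge dvd_imp_le[of a1 a] by auto
      ultimately show False using int_a by linarith
    qed
    then have "2 ^ m dvd x"
      using two_pow_m_dvd_exponent[OF a12(1)] a12(2) cong False \<open>a1 > 0\<close> xyz by simp
    then show ?thesis by blast
  qed (auto intro: exI[of _ "2 ^ m"])
  then obtain x' where x': "a1 ^ x' = a1 ^ x" "2 ^ m dvd x'" by blast
  obtain p where p: "prime p" "p dvd a2" using a12(2) prime_factor_nat[of a2] by auto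
  have pa: "p dvd a" using p(2) a12(1) by auto
  have "[b ^ y * w = 0] (mod p)" using w(2)[OF p] by (simp add: cong_0_iff)
  then have "[a1 ^ x + b ^ y * w = a1 ^ x + 0] (mod p)" by (intro cong_add cong_refl)
  then have "[a1 ^ x' = 2 ^ z] (mod p)"
    unfolding eq x' using cong_c_2[OF pa, of z] by (metis add_0_right cong_sym cong_trans)
  then have "even z" using even_exponent_if_cong[OF p(1) pa] x'(2) by blast
  then obtain j where j: "z = 2 * j" by auto
  have "even x'" using x'(2) m_pos by (meson dvd_power dvd_trans less_le_trans zero_less_one)
  then obtain i where i: "x' = 2 * i" by auto
  have "(a1 ^ i)\<^sup>2 + b ^ y * w = c ^ (2 * j)"
    using eq x'(1) by (simp add: i j power_mult[symmetric] mult.commute)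
  moreover have "odd (a1 ^ i)" using a12(1) odd_a by auto
  ultimately show False using no_square_plus_power[of "a1 ^ i" y w j] xyz w(1) j by simp
qed

text \<open>\<open>n ^ (z - x)\<close> divides \<open>a ^ x\<close>; let \<open>K\<close> be the
  quotient. A prime common to \<open>n\<close> and \<open>K\<close> would divide both
  \<open>a\<close> and \<open>c\<close>, so \<open>n ^ (z - x)\<close> and \<open>K\<close> are
  coprime and are both \<open>x\<close>-th powers.\<close>

lemma no_solution_x_lt_z_lt_y:
  assumes eq: "a ^ x + b ^ y * n ^ (y - x) = c ^ z * n ^ (z - x)"
    and n: "n > 1" and xyz: "0 < x" "x < z" "z < y"
  shows False
proof -
  have e: "y - x = (y - z) + (z - x)" using xyz by simp
  have "n ^ (z - x) dvd a ^ x"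
  proof -
    have "n ^ (z - x) dvd a ^ x + b ^ y * n ^ (y - x)" unfolding eq by simp
    moreover have "n ^ (z - x) dvd b ^ y * n ^ (y - x)" by (simp add: e power_add)
    ultimately show ?thesis by (simp only: dvd_add_left_iff)
  qed
  then obtain K where K: "a ^ x = n ^ (z - x) * K" by auto
  have "n ^ (z - x) * (K + b ^ y * n ^ (y - z)) = n ^ (z - x) * c ^ z"
    using eq by (simp add: e power_add K algebra_simps)
  then have eq': "K + b ^ y * n ^ (y - z) = c ^ z" using n by simp
  have "gcd n K = 1"
  proof (rule ccontr)
    assume "gcd n K \<noteq> 1"
    then obtain p where p: "prime p" "p dvd gcd n K" using prime_factor_nat by blast
    then have pn: "p dvd n" "p dvd K" by auto
    have "n dvd n ^ (y - z)" using xyz by (intro dvd_power) auto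
    then have "p dvd K + b ^ y * n ^ (y - z)" using pn by (meson dvd_add dvd_mult dvd_trans)
    then have "p dvd c" using eq' p(1) prime_dvd_power by metis
    moreover have "p dvd a" using pn K p(1) prime_dvd_power by (metis dvd_mult)
    ultimately show False using coprime_ac p(1) by (meson coprime_common_divisor not_prime_unit)
  qed
  then have "coprime n K" by (rule gcd_eq_1_imp_coprime)
  then have "coprime (n ^ (z - x)) K" by simp
  then obtain a2 a1 where a12: "n ^ (z - x) = a2 ^ x" "K = a1 ^ x" "a2 * a1 = a"
    using coprime_mult_eq_powerE[of "n ^ (z - x)" K a x] K xyz by metis
  show False
  proof (rule no_solution_factored)
    show "a1 * a2 = a" using a12(3) by (simp add: mult.commute)
    have "a2 ^ x > 1" using a12(1) n xyz by (metis one_less_power zero_less_diff)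
    then show "a2 > 1" using xyz(1) by (cases "a2 = 0 \<or> a2 = 1") (auto simp: power_0_left)
    show "a1 ^ x + b ^ y * n ^ (y - z) = c ^ z" using eq' a12(2) by simp
    show "p dvd n ^ (y - z)" if "prime p" "p dvd a2" for p
    proof -
      have "p dvd a2 ^ x" using that xyz by (metis dvd_power dvd_trans)
      then have "p dvd n" using a12(1) that(1) prime_dvd_power by metis
      moreover have "n dvd n ^ (y - z)" using xyz by (intro dvd_power) auto
      ultimately show ?thesis using dvd_trans by blast
    qed
  qed (use xyz n in auto)
qed

section \<open>The case \<open>n = 1\<close>\<close>

text \<open>Modulo 4 the exponent \<open>x\<close> must be even. If \<open>z\<close> were odd, then
  modulo \<open>2 * u^2\<close> the equation gives \<open>b ^ y = c - 1 = u^2\<close>, whereas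
  \<open>b ^ y\<close> is 0 for \<open>y \<ge> 2\<close>. The case \<open>y = 1\<close> leaves only
  \<open>u = 2\<close>, excluded modulo 3.\<close>

lemma even_exponents_primitive:
  assumes eq: "a ^ x + b ^ y = c ^ z" and pos: "x > 0" "y > 0" "z > 0"
  shows "even x \<and> even z"
proof
  have diff: "int c ^ z - int a ^ x = int b ^ y" using arg_cong[OF eq, of int] by simp
  show x: "even x"
  proof (rule ccontr)
    assume "odd x"
    have "4 dvd int b" using four_dvd_b by presburger
    then have "4 dvd int b ^ y" using pos dvd_power dvd_trans by blast
    then have "[int c ^ z = int a ^ x] (mod 4)" by (simp only: cong_iff_dvd_diff diff)
    moreover have "[int a ^ x = (- 1) ^ x] (mod 4)" by (intro cong_pow cong_a_4)
    moreover have "[int c ^ z = 1 ^ z] (mod 4)"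
      using cong_a_4 by (intro cong_pow) (simp add: c_eq cong_iff_dvd_diff add.commute)
    ultimately have "[1 ^ z = (- 1) ^ x] (mod (4::int))" by (meson cong_sym cong_trans)
    then show False using \<open>odd x\<close> by (simp add: cong_iff_dvd_diff)
  qed
  have ax: "[int a ^ x = 1] (mod 2 * (int u)\<^sup>2)" using cong_even_power[OF cong_a_sq x] .
  show "even z"
  proof (rule ccontr)
    assume z: "odd z"
    have "[int c * int c ^ (z - 1) = int c * 1] (mod 2 * (int u)\<^sup>2)"
      using z by (intro cong_mult cong_refl cong_even_power[OF cong_c_sq]) simp
    moreover have "int c * int c ^ (z - 1) = int c ^ z" using pos by (cases z) auto
    ultimately have cz: "[int c ^ z = int c] (mod 2 * (int u)\<^sup>2)" by simp
    have "[int c ^ z - int a ^ x = int c - 1] (mod 2 * (int u)\<^sup>2)" using cz ax by (rule cong_diff)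
    then have by_cong: "[int b ^ y = (int u)\<^sup>2] (mod 2 * (int u)\<^sup>2)" unfolding diff by (simp add: int_c)
    show False
    proof (cases "y \<ge> 2")
      case True
      then have "int (2 * u\<^sup>2) dvd int (b ^ y)" using two_u_sq_dvd by (simp only: int_dvd_int_iff)
      then have "2 * (int u)\<^sup>2 dvd int b ^ y" by simp
      then have "2 * (int u)\<^sup>2 dvd (int u)\<^sup>2" using cong_dvd_iff[OF by_cong] by blast
      then have "2 * (int u)\<^sup>2 \<le> (int u)\<^sup>2" using u_ge by (intro zdvd_imp_le) auto
      then show False using u_ge by simp
    next
      case False
      then have "y = 1" using pos by linarith
      then have "2 * (int u)\<^sup>2 dvd 2 * int u - (int u)\<^sup>2"
        using by_cong by (simp add: cong_iff_dvd_diff b)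
      then have "(int u)\<^sup>2 dvd 2 * int u - (int u)\<^sup>2" by (rule dvd_mult_right)
      then have "(int u)\<^sup>2 dvd (2 * int u - (int u)\<^sup>2) + (int u)\<^sup>2" by (intro dvd_add dvd_refl)
      then have "(int u)\<^sup>2 dvd 2 * int u" by simp
      then have "(int u)\<^sup>2 \<le> 2 * int u" using u_ge by (intro zdvd_imp_le) auto
      then have "u \<le> 2" using u_ge by (simp add: power2_eq_square)
      then have "u = 2" using u_ge by simp
      then have "a = 3" "b = 4" "c = 5" using a b c by auto
      then have "3 ^ x + 4 ^ y = (5::nat) ^ z" using eq by simp
      moreover have "[3 ^ x + 4 ^ y = 0 + 4 ^ y] (mod (3::nat))"
        using pos by (intro cong_add cong_refl) (simp add: cong_0_iff dvd_power)
      ultimately have "[4 ^ y = 5 ^ z] (mod (3::nat))" by (simp add: cong_sym_eq)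
      moreover have "[5 ^ z = 2 ^ z] (mod (3::nat))" by (intro cong_pow) (simp add: cong_def)
      moreover have "[4 ^ y = 1 ^ y] (mod (3::nat))" by (intro cong_pow) (simp add: cong_def)
      ultimately have "[2 ^ z = 1] (mod (3::nat))" by (metis cong_sym cong_trans power_one)
      then show False using even_if_cong_two_power z by blast
    qed
  qed
qed

text \<open>With even \<open>x\<close> and \<open>z\<close>, the number \<open>b ^ y\<close> is a
  difference of two squares, so \<open>C - A\<close> and \<open>C + A\<close> are powers of 2. Since
  \<open>A\<close> is odd they cannot both be divisible by 4, so \<open>C = A + 2\<close>, and
  \<open>a ^ i + 1\<close> is a power of 2.\<close>

lemma primitive_solution:
  assumes eq: "a ^ x + b ^ y = c ^ z" and pos: "x > 0" "y > 0" "z > 0"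
  shows "x = 2 \<and> y = 2 \<and> z = 2"
proof -
  obtain i j where ij: "x = 2 * i" "z = 2 * j"
    using even_exponents_primitive[OF assms] by (metis evenE)
  let ?A = "a ^ i" and ?C = "c ^ j"
  have eq': "?C\<^sup>2 = ?A\<^sup>2 + b ^ y" using eq by (simp only: ij power_mult[symmetric] mult.commute)
  moreover have "b ^ y > 0" using b_ge by simp
  ultimately have "?A\<^sup>2 < ?C\<^sup>2" by linarith
  then have AC: "?A < ?C" by (rule power_less_imp_less_base) simp
  then obtain e where e: "?C = ?A + e" using le_Suc_ex[OF less_imp_le[OF AC]] by blast
  have "e * (2 * ?A + e) = b ^ y" using eq' unfolding e by (simp add: algebra_simps power2_eq_square)
  then have "e * (2 * ?A + e) = 2 ^ ((m + 1) * y)" by (simp only: b_eq power_mult)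
  then obtain f g where fg: "e = 2 ^ f" "2 * ?A + e = 2 ^ g"
    using prime_power_mult_nat[OF two_is_prime_nat] by metis
  have A3: "?A \<ge> 3"
  proof -
    have "a ^ 1 \<le> a ^ i" using a_ge ij pos by (intro power_increasing) auto
    then show ?thesis using a_ge by simp
  qed
  have odd: "odd ?A" "odd ?C" using odd_a odd_c by auto
  then have "even e" using e by auto
  have "g \<ge> 3"
  proof (rule ccontr)
    assume "\<not> g \<ge> 3"
    then have "(2::nat) ^ g \<le> 2 ^ 2" by (intro power_increasing) auto
    then show False using fg A3 by simp
  qed
  then have "2 ^ 3 dvd (2::nat) ^ g" by (intro le_imp_power_dvd)
  then have g4: "4 dvd 2 * ?A + e" using fg(2) by simp presburger
  have "f = 1"
  proof (rule ccontr)
    assume "f \<noteq> 1"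
    moreover have "f \<noteq> 0" using fg(1) \<open>even e\<close> by (intro notI) simp
    ultimately have "2 ^ 2 dvd (2::nat) ^ f" by (intro le_imp_power_dvd) simp
    then have "4 dvd e" using fg by simp
    then have "4 dvd 2 * ?A" using g4 by presburger
    then show False using odd(1) by presburger
  qed
  then have e2: "e = 2" using fg by simp
  have "2 * (?A + 1) = 2 ^ g" using fg(2) e2 by simp
  moreover obtain t where t: "g = Suc t" "t \<ge> 2" using \<open>g \<ge> 3\<close> by (cases g) auto
  ultimately have At: "?A + 1 = 2 ^ t" by simp
  have int_At: "int a ^ i = 2 ^ t - 1" using arg_cong[OF At, of int] by simp
  have "odd i"
  proof (rule ccontr)
    assume "\<not> odd i"
    have "[int a ^ i = (- 1) ^ i] (mod 4)" by (intro cong_pow cong_a_4)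
    moreover have "2 ^ 2 dvd (2::int) ^ t" using t by (intro le_imp_power_dvd)
    then have "4 dvd (2::int) ^ t" by simp
    ultimately have "4 dvd (2::int) ^ t - 2" "4 dvd (2::int) ^ t"
      using \<open>\<not> odd i\<close> by (simp_all add: int_At cong_iff_dvd_diff)
    then show False by presburger
  qed
  \<comment> \<open>The odd exponent \<open>i\<close> can be removed modulo \<open>2 ^ t\<close>, so
    \<open>2 ^ t = a ^ i + 1\<close> divides \<open>a + 1\<close>, which forces
    \<open>i = 1\<close>.\<close>
  then have "[(- int a) ^ i = 1] (mod 2 ^ t)" by (simp add: int_At cong_iff_dvd_diff)
  then have "[- int a = 1] (mod 2 ^ t)"
    by (rule pow_cong_one_odd_exponent[OF \<open>odd i\<close>]) (use t in simp)
  then have "2 ^ t dvd - int a - 1" by (simp only: cong_iff_dvd_diff)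
  then have "2 ^ t dvd - (- int a - 1)" by (simp only: dvd_minus_iff)
  then have "2 ^ t dvd int a + 1" by (simp add: add.commute)
  then have "2 ^ t \<le> int a + 1" by (intro zdvd_imp_le) auto
  then have "int (a ^ i) \<le> int a" using int_At by simp
  then have "a ^ i \<le> a ^ 1" by simp
  then have "i \<le> 1" using a_ge by (simp only: power_increasing_iff)
  then have i: "i = 1" using ij pos by simp
  then have "c ^ j = c ^ 1" using e e2 c_eq by simp
  then have j: "j = 1" using c_eq by (simp only: power_inject_exp)
  have "b ^ y = b ^ 2" using eq' i j pyth by simp
  then have "y = 2" using b_ge by (simp add: power_inject_exp)
  then show ?thesis using i j ij by simp
qed

section \<open>Combination of the cases\<close>

lemma solution_iff:
  assumes pos: "n > 0" "x > 0" "y > 0" "z > 0"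
  shows "(a * n) ^ x + (b * n) ^ y = (c * n) ^ z \<longleftrightarrow> (x, y, z) = (2, 2, 2)"
proof
  assume "(x, y, z) = (2, 2, 2)"
  then show "(a * n) ^ x + (b * n) ^ y = (c * n) ^ z"
    by (simp add: power_mult_distrib pyth[symmetric] distrib_right)
next
  assume eq0: "(a * n) ^ x + (b * n) ^ y = (c * n) ^ z"
  then have eq: "a ^ x * n ^ x + b ^ y * n ^ y = c ^ z * n ^ z" by (simp add: power_mult_distrib)
  have cancel: "a ^ x * n ^ (x - d) + b ^ y * n ^ (y - d) = c ^ z * n ^ (z - d)"
    if "d \<le> x" "d \<le> y" "d \<le> z" for d
  proof -
    have "n ^ x = n ^ d * n ^ (x - d)" "n ^ y = n ^ d * n ^ (y - d)" "n ^ z = n ^ d * n ^ (z - d)"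
      using that by (simp_all add: power_add[symmetric])
    with eq have "n ^ d * (a ^ x * n ^ (x - d) + b ^ y * n ^ (y - d)) = n ^ d * (c ^ z * n ^ (z - d))"
      by (simp only: algebra_simps)
    then show ?thesis using pos(1) by simp
  qed
  show "(x, y, z) = (2, 2, 2)"
  proof (cases "n = 1")
    case True
    then show ?thesis using primitive_solution[of x y z] eq pos by simp
  next
    case False
    then have n: "n > 1" using pos by simp
    \<comment> \<open>Sorted by the position of \<open>z\<close>. Outside the first case,
      \<open>cancel\<close> is applied with the smallest of the three exponents.\<close>
    consider "x \<le> z" "y \<le> z" | "z < x" "z < y" | "y = z" "z < x" | "x = z" "z < y"
      | "y < z" "z < x" | "x < z" "z < y" by linarith
    then show ?thesis
    proof cases
      case 1
      then show ?thesis using solution_z_max[OF eq0] pos by simp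
    next
      case 2
      then show ?thesis using no_solution_z_min[of x n z y] cancel[of z] n pos by simp
    next
      case 3
      then show ?thesis using no_solution_y_eq_z[of x "n ^ (x - z)" z] cancel[of z] pos by simp
    next
      case 4
      then show ?thesis using no_solution_x_eq_z[of z y "n ^ (y - z)"] cancel[of z] pos by simp
    next
      case 5
      then show ?thesis using no_solution_y_lt_z_lt_x[of x n y z] cancel[of y] n pos by simp
    next
      case 6
      then show ?thesis using no_solution_x_lt_z_lt_y[of x y n z] cancel[of x] n pos by simp
    qed
  qed
qed

end

theorem theorem1:
  fixes k n x y z :: nat
  assumes "k \<ge> 1" and "n > 0" and "x > 0" and "y > 0" and "z > 0"
  shows "((fermat_number k - 2) * n) ^ x + (2 ^ (2 ^ (k - 1) + 1) * n) ^ y = (fermat_number k * n) ^ z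
    \<longleftrightarrow> (x, y, z) = (2, 2, 2)"
proof -
  let ?m = "2 ^ (k - 1) :: nat"
  have m: "2 * ?m = 2 ^ k" using assms(1) by (cases k) auto
  have "(2 ^ ?m)\<^sup>2 = (2::nat) ^ (2 * ?m)" by (subst mult.commute) (rule power_mult[symmetric])
  then have sq: "(2 ^ ?m)\<^sup>2 = (2::nat) ^ 2 ^ k" by (simp only: m)
  \<comment> \<open>Ensures that the subtraction in \<open>fermat_number k - 2\<close> is not
    truncated.\<close>
  have "2 ^ 1 \<le> (2::nat) ^ 2 ^ k" by (intro power_increasing) auto
  then interpret fermat_triple k ?m "2 ^ ?m" "fermat_number k - 2" "2 ^ (?m + 1)" "fermat_number k"
    using assms(1) m sq by unfold_locales (simp_all add: fermat_number_def)
  show ?thesis using assms by (intro solution_iff)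
qed

end
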